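(* Let $\vdash$ be a finitary logic satisfying the standing assumption below, suppose $\vdash$ has no antitheorems, and suppose $\vdash\neq\vdash^{r}$ and $\vdash\neq\vdash^{l}$. Then: (i) $\vdash^{l}\not\leq\vdash^{r}$ and $\vdash^{r}\not\leq\vdash^{l}$; (ii) $\vdash^{l}\cap\vdash^{r}=\vdash^{lr}$, and $\vdash^{lr}$ is strictly below both $\vdash^{l}$ and $\vdash^{r}$ (i.e. $\vdash^{lr}\leq\vdash^{l}$, $\vdash^{lr}\leq\vdash^r$, and $\vdash^{lr}\neq\vdash^{l}$, $\vdash^{lr}\neq\vdash^{r}$); (iii) $\vdash^{rl}=\vdash^{rl\bullet}=\vdash^{lrl\bullet}$ for every finite (possibly empty) sequence $\bullet$ over $\{l,r\}$.
   Context: Fix an algebraic language and let $Fm$ be the set of formulas built over a countably infinite set $\mathrm{Var}$ of variables. For a formula $\varphi$, $\mathrm{Var}(\varphi)$ is the set of variables occurring in $\varphi$, and for $\Gamma\subseteq Fm$, $\mathrm{Var}(\Gamma)=\bigcup_{\gamma\in\Gamma}\mathrm{Var}(\gamma)$. A logic is a consequence relation $\vdash\subseteq\mathcal{P}(Fm)\times Fm$ invariant under substitutions; it is finitary if $\Gamma\vdash\varphi$ iff $\Delta\vdash\varphi$ for some finite $\Delta\subseteq\Gamma$. Logics are identified with subsets of $\mathcal{P}(Fm)\times Fm$; $\vdash'\leq\vdash''$ means $\vdash'\subseteq\vdash''$, and $\cap$ is intersection (the meet in the lattice of logics). A set $\Sigma$ of formulas is an antitheorem of $\vdash$ if $\sigma[\Sigma]\vdash\varphi$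 for every substitution $\sigma$ and every formula $\varphi$. For a logic $\vdash$: $\Gamma\vdash^{l}\varphi$ iff there is $\Delta\subseteq\Gamma$ with $\mathrm{Var}(\Delta)\subseteq\mathrm{Var}(\varphi)$ and $\Delta\vdash\varphi$; $\Gamma\vdash^{r}\varphi$ iff either ($\Gamma\vdash\varphi$ and $\mathrm{Var}(\varphi)\subseteq\mathrm{Var}(\Gamma)$) or $\Sigma\subseteq\Gamma$ for some antitheorem $\Sigma$ of $\vdash$. For a finite sequence $u_1\dots u_n$ over $\{l,r\}$, $\vdash^{u_1\dots u_n}$ is the result of applying the operation $u_n$ to $\vdash^{u_1\dots u_{n-1}}$ (the empty sequence gives $\vdash$); juxtaposition denotes concatenation of sequences. Standing assumption: $\vdash$ is finitary and there is a binary formula $\pi(x,y)$, in which $x$ and $y$ really occur, that is an $l$-partition function for $\vdash^l$ and an $r$-partition function for $\vdash^r$. Here: for a logic $\vdash'$, $\mathrm{Alg}(\vdash')$ is the class of algebraic reducts of the reduced matrix models of $\vdash'$; a binary operation $\cdot$ on an algebra is a partition function if for all $a,b,c$ and every basic operation $g$ of arity $n\ge1$: $a\cdot a=a$; $a\cdot(b\cdot c)=(a\cdot b)\cdot c$; $a\cdot(b\cdot c)=a\cdot(c\cdot b)$; $g(a_1,\dots,a_n)\cdot b=g(a_1\cdot b,\dots,a_n\cdot b)$; $b\cdot g(a_1,\dots,a_n)=b\cdot a_1\cdot\ldots\cdot a_n$. A formula $x\cdot y$ is an $l$-partition function for $\vdash'$ if $x\vdash' x\cdot y$ and these five conditions hold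 as equations in every algebra of $\mathrm{Alg}(\vdash')$; a formula $x\ast y$ is an $r$-partition function for $\vdash'$ if $x,y\vdash' x\ast y$, $x\ast y\vdash' x$, and $\ast$ is a partition function in every algebra of $\mathrm{Alg}(\vdash')$. *)

theory Defs
  imports Main
begin

section \<open>Formulas\<close>

datatype 'f fm = Var nat | Op 'f "'f fm list"

primrec vars :: "'f fm \<Rightarrow> nat set" where
  "vars (Var v) = {v}"
| "vars (Op f ts) = \<Union> (set (map vars ts))"

definition Vars :: "'f fm set \<Rightarrow> nat set" where
  "Vars \<Gamma> = (\<Union>\<gamma>\<in>\<Gamma>. vars \<gamma>)"

text \<open>
  A language is a type \<open>'f\<close> of operation symbols with an arity function; \<open>Fm ar\<close> is its set of
  formulas. Terms of type \<open>'f fm\<close> outside \<open>Fm ar\<close> violate the arities.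
\<close>

inductive_set Fm :: "('f \<Rightarrow> nat) \<Rightarrow> 'f fm set" for ar :: "'f \<Rightarrow> nat" where
  Fm_Var: "Var v \<in> Fm ar"
| Fm_Op: "length ts = ar f \<Longrightarrow> (\<And>t. t \<in> set ts \<Longrightarrow> t \<in> Fm ar) \<Longrightarrow> Op f ts \<in> Fm ar"

primrec subst :: "(nat \<Rightarrow> 'f fm) \<Rightarrow> 'f fm \<Rightarrow> 'f fm" where
  "subst \<sigma> (Var v) = \<sigma> v"
| "subst \<sigma> (Op f ts) = Op f (map (subst \<sigma>) ts)"

definition substitution :: "('f \<Rightarrow> nat) \<Rightarrow> (nat \<Rightarrow> 'f fm) \<Rightarrow> bool" where
  "substitution ar \<sigma> \<longleftrightarrow> (\<forall>v. \<sigma> v \<in> Fm ar)"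

section \<open>Logics\<close>

type_synonym 'f logic = "('f fm set \<times> 'f fm) set"

definition is_logic :: "('f \<Rightarrow> nat) \<Rightarrow> 'f logic \<Rightarrow> bool" where
  "is_logic ar L \<longleftrightarrow>
     L \<subseteq> Pow (Fm ar) \<times> Fm ar \<and>
     (\<forall>\<Gamma> \<phi>. \<Gamma> \<subseteq> Fm ar \<longrightarrow> \<phi> \<in> \<Gamma> \<longrightarrow> (\<Gamma>, \<phi>) \<in> L) \<and>
     (\<forall>\<Gamma> \<Delta> \<phi>. \<Gamma> \<subseteq> Fm ar \<longrightarrow> (\<forall>\<delta>\<in>\<Delta>. (\<Gamma>, \<delta>) \<in> L) \<longrightarrow> (\<Delta>, \<phi>) \<in> L \<longrightarrow> (\<Gamma>, \<phi>) \<in> L) \<and>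
     (\<forall>\<sigma> \<Gamma> \<phi>. substitution ar \<sigma> \<longrightarrow> (\<Gamma>, \<phi>) \<in> L \<longrightarrow> (subst \<sigma> ` \<Gamma>, subst \<sigma> \<phi>) \<in> L)"

definition finitary :: "('f \<Rightarrow> nat) \<Rightarrow> 'f logic \<Rightarrow> bool" where
  "finitary ar L \<longleftrightarrow>
     (\<forall>\<Gamma> \<phi>. \<Gamma> \<subseteq> Fm ar \<longrightarrow> \<phi> \<in> Fm ar \<longrightarrow>
        ((\<Gamma>, \<phi>) \<in> L \<longleftrightarrow> (\<exists>\<Delta>. finite \<Delta> \<and> \<Delta> \<subseteq> \<Gamma> \<and> (\<Delta>, \<phi>) \<in> L)))"

definition antitheorem :: "('f \<Rightarrow> nat) \<Rightarrow> 'f logic \<Rightarrow> 'f fm set \<Rightarrow> bool" where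
  "antitheorem ar L \<Sigma> \<longleftrightarrow>
     \<Sigma> \<subseteq> Fm ar \<and> (\<forall>\<sigma> \<phi>. substitution ar \<sigma> \<longrightarrow> \<phi> \<in> Fm ar \<longrightarrow> (subst \<sigma> ` \<Sigma>, \<phi>) \<in> L)"

section \<open>Variable inclusion companions\<close>

definition left_comp :: "('f \<Rightarrow> nat) \<Rightarrow> 'f logic \<Rightarrow> 'f logic" where
  "left_comp ar L = {(\<Gamma>, \<phi>). \<Gamma> \<subseteq> Fm ar \<and> \<phi> \<in> Fm ar \<and>
     (\<exists>\<Delta>\<subseteq>\<Gamma>. Vars \<Delta> \<subseteq> vars \<phi> \<and> (\<Delta>, \<phi>) \<in> L)}"

definition right_comp :: "('f \<Rightarrow> nat) \<Rightarrow> 'f logic \<Rightarrow> 'f logic" where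
  "right_comp ar L = {(\<Gamma>, \<phi>). \<Gamma> \<subseteq> Fm ar \<and> \<phi> \<in> Fm ar \<and>
     (((\<Gamma>, \<phi>) \<in> L \<and> vars \<phi> \<subseteq> Vars \<Gamma>) \<or> (\<exists>\<Sigma>\<subseteq>\<Gamma>. antitheorem ar L \<Sigma>))}"

datatype side = Lft | Rgt

fun side_comp :: "('f \<Rightarrow> nat) \<Rightarrow> 'f logic \<Rightarrow> side \<Rightarrow> 'f logic" where
  "side_comp ar L Lft = left_comp ar L"
| "side_comp ar L Rgt = right_comp ar L"

text \<open>The head of the list is applied first.\<close>

definition comp_seq :: "('f \<Rightarrow> nat) \<Rightarrow> 'f logic \<Rightarrow> side list \<Rightarrow> 'f logic" where
  "comp_seq ar L us = foldl (side_comp ar) L us"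

section \<open>Algebras and reduced matrix models\<close>

record ('f, 'a) alg =
  carr :: "'a set"
  interp :: "'f \<Rightarrow> 'a list \<Rightarrow> 'a"

definition algebra :: "('f \<Rightarrow> nat) \<Rightarrow> ('f, 'a) alg \<Rightarrow> bool" where
  "algebra ar A \<longleftrightarrow> carr A \<noteq> {} \<and>
     (\<forall>f as. length as = ar f \<longrightarrow> set as \<subseteq> carr A \<longrightarrow> interp A f as \<in> carr A)"

primrec eval :: "('f, 'a) alg \<Rightarrow> (nat \<Rightarrow> 'a) \<Rightarrow> 'f fm \<Rightarrow> 'a" where
  "eval A h (Var v) = h v"
| "eval A h (Op f ts) = interp A f (map (eval A h) ts)"

definition congruence :: "('f \<Rightarrow> nat) \<Rightarrow> ('f, 'a) alg \<Rightarrow> ('a \<times> 'a) set \<Rightarrow> bool" where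
  "congruence ar A \<theta> \<longleftrightarrow> equiv (carr A) \<theta> \<and>
     (\<forall>f as bs. length as = ar f \<longrightarrow> list_all2 (\<lambda>a b. (a, b) \<in> \<theta>) as bs \<longrightarrow>
        (interp A f as, interp A f bs) \<in> \<theta>)"

definition compatible :: "('a \<times> 'a) set \<Rightarrow> 'a set \<Rightarrow> bool" where
  "compatible \<theta> F \<longleftrightarrow> (\<forall>(a, b)\<in>\<theta>. a \<in> F \<longrightarrow> b \<in> F)"

text \<open>
  The largest congruence of \<open>A\<close> compatible with \<open>F\<close>; that the union is itself one is
  \<open>leibniz_congruence\<close> and \<open>leibniz_compatible\<close> below.
\<close>

definition leibniz :: "('f \<Rightarrow> nat) \<Rightarrow> ('f, 'a) alg \<Rightarrow> 'a set \<Rightarrow> ('a \<times> 'a) set" where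
  "leibniz ar A F = \<Union> {\<theta>. congruence ar A \<theta> \<and> compatible \<theta> F}"

definition matrix_model :: "('f \<Rightarrow> nat) \<Rightarrow> 'f logic \<Rightarrow> ('f, 'a) alg \<Rightarrow> 'a set \<Rightarrow> bool" where
  "matrix_model ar L A F \<longleftrightarrow> algebra ar A \<and> F \<subseteq> carr A \<and>
     (\<forall>(\<Gamma>, \<phi>)\<in>L. \<forall>h. range h \<subseteq> carr A \<longrightarrow> eval A h ` \<Gamma> \<subseteq> F \<longrightarrow> eval A h \<phi> \<in> F)"

definition reduced :: "('f \<Rightarrow> nat) \<Rightarrow> ('f, 'a) alg \<Rightarrow> 'a set \<Rightarrow> bool" where
  "reduced ar A F \<longleftrightarrow> leibniz ar A F = Id_on (carr A)"

text \<open>The members of \<open>Alg(L)\<close> whose universe is a subset of the type \<open>'a\<close>.\<close>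

definition Alg :: "('f \<Rightarrow> nat) \<Rightarrow> 'f logic \<Rightarrow> ('f, 'a) alg set" where
  "Alg ar L = {A. \<exists>F. matrix_model ar L A F \<and> reduced ar A F}"

section \<open>Partition functions\<close>

definition partition_function ::
    "('f \<Rightarrow> nat) \<Rightarrow> ('f, 'a) alg \<Rightarrow> ('a \<Rightarrow> 'a \<Rightarrow> 'a) \<Rightarrow> bool" where
  "partition_function ar A m \<longleftrightarrow>
     (\<forall>a\<in>carr A. m a a = a) \<and>
     (\<forall>a\<in>carr A. \<forall>b\<in>carr A. \<forall>c\<in>carr A. m a (m b c) = m (m a b) c) \<and>
     (\<forall>a\<in>carr A. \<forall>b\<in>carr A. \<forall>c\<in>carr A. m a (m b c) = m a (m c b)) \<and>
     (\<forall>g as. \<forall>b\<in>carr A. ar g \<ge> 1 \<longrightarrow> length as = ar g \<longrightarrow> set as \<subseteq> carr A \<longrightarrow>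
        m (interp A g as) b = interp A g (map (\<lambda>a. m a b) as)) \<and>
     (\<forall>g as. \<forall>b\<in>carr A. ar g \<ge> 1 \<longrightarrow> length as = ar g \<longrightarrow> set as \<subseteq> carr A \<longrightarrow>
        m b (interp A g as) = foldl m b as)"

text \<open>
  The binary operation that a formula \<open>p\<close> with \<open>vars p = {x, y}\<close> induces on \<open>A\<close>: the first
  argument is the value of \<open>x\<close>, the second that of \<open>y\<close>.
\<close>

definition bin_op :: "('f, 'a) alg \<Rightarrow> nat \<Rightarrow> nat \<Rightarrow> 'f fm \<Rightarrow> 'a \<Rightarrow> 'a \<Rightarrow> 'a" where
  "bin_op A x y p a b = eval A (\<lambda>v. if v = x then a else b) p"

definition binary_formula :: "('f \<Rightarrow> nat) \<Rightarrow> nat \<Rightarrow> nat \<Rightarrow> 'f fm \<Rightarrow> bool" where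
  "binary_formula ar x y p \<longleftrightarrow> x \<noteq> y \<and> p \<in> Fm ar \<and> vars p = {x, y}"

text \<open>
  HOL cannot quantify over universes of all types inside a formula, so \<open>Alg(L)\<close> is taken here over
  universes \<open>\<subseteq> 'f fm\<close>. Nothing is lost: by \<open>Alg_partition_function_any_type\<close> below, the partition
  function identities then hold in \<open>Alg(L)\<close> over every type.
\<close>

definition Alg_partition_function ::
    "('f \<Rightarrow> nat) \<Rightarrow> 'f logic \<Rightarrow> nat \<Rightarrow> nat \<Rightarrow> 'f fm \<Rightarrow> bool" where
  "Alg_partition_function ar L x y p \<longleftrightarrow>
     (\<forall>A\<in>(Alg ar L :: ('f, 'f fm) alg set). partition_function ar A (bin_op A x y p))"

definition l_partition_function ::
    "('f \<Rightarrow> nat) \<Rightarrow> 'f logic \<Rightarrow> nat \<Rightarrow> nat \<Rightarrow> 'f fm \<Rightarrow> bool" where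
  "l_partition_function ar L x y p \<longleftrightarrow>
     ({Var x}, p) \<in> L \<and> Alg_partition_function ar L x y p"

definition r_partition_function ::
    "('f \<Rightarrow> nat) \<Rightarrow> 'f logic \<Rightarrow> nat \<Rightarrow> nat \<Rightarrow> 'f fm \<Rightarrow> bool" where
  "r_partition_function ar L x y p \<longleftrightarrow>
     ({Var x, Var y}, p) \<in> L \<and> ({p}, Var x) \<in> L \<and> Alg_partition_function ar L x y p"

section \<open>The Leibniz congruence\<close>

lemma congruence_op1:
  assumes "congruence ar A \<theta>" "(a, b) \<in> \<theta>" "set xs \<subseteq> carr A" "set ys \<subseteq> carr A"
    "length xs + Suc (length ys) = ar f"
  shows "(interp A f (xs @ a # ys), interp A f (xs @ b # ys)) \<in> \<theta>"
proof -
  have r: "\<And>z. z \<in> carr A \<Longrightarrow> (z, z) \<in> \<theta>"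
    using assms(1) unfolding congruence_def equiv_def refl_on_def by blast
  have R: "list_all2 (\<lambda>a b. (a, b) \<in> \<theta>) zs zs" if "set zs \<subseteq> carr A" for zs
    using that r by (auto simp: list_all2_same)
  have "list_all2 (\<lambda>a b. (a, b) \<in> \<theta>) (xs @ a # ys) (xs @ b # ys)"
    using R assms(2-4) by (simp add: list_all2_appendI)
  thus ?thesis using assms(1,5) unfolding congruence_def by simp
qed

lemma congruence_if_op1:
  assumes eq: "equiv (carr A) \<theta>"
    and op: "\<And>f xs ys a b. (a, b) \<in> \<theta> \<Longrightarrow> set xs \<subseteq> carr A \<Longrightarrow> set ys \<subseteq> carr A \<Longrightarrow>
       length xs + Suc (length ys) = ar f \<Longrightarrow>
       (interp A f (xs @ a # ys), interp A f (xs @ b # ys)) \<in> \<theta>"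
    and alg: "algebra ar A"
  shows "congruence ar A \<theta>"
proof -
  have sub: "\<theta> \<subseteq> carr A \<times> carr A" and tr: "trans \<theta>" and rf: "\<And>z. z \<in> carr A \<Longrightarrow> (z, z) \<in> \<theta>"
    using eq unfolding equiv_def refl_on_def by auto
  have "(interp A f (xs @ as), interp A f (xs @ bs)) \<in> \<theta>"
    if "list_all2 (\<lambda>a b. (a, b) \<in> \<theta>) as bs" "set xs \<subseteq> carr A" "length xs + length as = ar f"
    for f xs as bs
    using that
  proof (induction as bs arbitrary: xs rule: list_all2_induct)
    case Nil
    thus ?case using rf alg unfolding algebra_def by auto
  next
    case (Cons a as b bs)
    have m: "a \<in> carr A" "b \<in> carr A" "set as \<subseteq> carr A"
    proof -
      show "a \<in> carr A" "b \<in> carr A" using Cons(1) sub by auto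
      show "set as \<subseteq> carr A" using Cons(2) sub by (force simp: list_all2_conv_all_nth in_set_conv_nth)
    qed
    have "(interp A f (xs @ a # as), interp A f (xs @ b # as)) \<in> \<theta>"
      using op Cons(1) Cons.prems m by simp
    moreover have "(interp A f ((xs @ [b]) @ as), interp A f ((xs @ [b]) @ bs)) \<in> \<theta>"
      using Cons.IH[of "xs @ [b]"] Cons.prems m by simp
    ultimately show ?case using tr by (auto elim: transE)
  qed
  from this[of _ _ "[]"] show ?thesis using eq unfolding congruence_def by auto
qed

lemma Id_on_congruence: "algebra ar A \<Longrightarrow> congruence ar A (Id_on (carr A))"
  by (rule congruence_if_op1)
    (auto simp: algebra_def equiv_def refl_on_def sym_def trans_def)

lemma leibniz_trancl:
  fixes F :: "'a set"
  assumes alg: "algebra ar A"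
  defines "\<Theta> \<equiv> (leibniz ar A F)\<^sup>+"
  shows "congruence ar A \<Theta>" "compatible \<Theta> F"
proof -
  let ?U = "leibniz ar A F"
  have sub: "?U \<subseteq> carr A \<times> carr A"
    unfolding leibniz_def congruence_def equiv_def by blast
  have subT: "\<Theta> \<subseteq> carr A \<times> carr A"
    unfolding \<Theta>_def using sub by (rule trancl_subset_Sigma)
  have symU: "sym ?U"
    unfolding leibniz_def congruence_def equiv_def sym_def by blast
  have rf: "Id_on (carr A) \<subseteq> ?U"
    using Id_on_congruence[OF alg] unfolding leibniz_def compatible_def by auto
  have "equiv (carr A) \<Theta>"
    unfolding equiv_def refl_on_def
    using subT rf symU by (auto simp: \<Theta>_def sym_trancl)
  thus "congruence ar A \<Theta>"
  proof (rule congruence_if_op1[OF _ _ alg])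
    fix f xs ys a b
    assume ab: "(a, b) \<in> \<Theta>" and s: "set xs \<subseteq> carr A" "set ys \<subseteq> carr A"
      "length xs + Suc (length ys) = ar f"
    have one: "(interp A f (xs @ c # ys), interp A f (xs @ d # ys)) \<in> ?U" if "(c, d) \<in> ?U" for c d
      using that congruence_op1[of ar A _ c d xs ys f] s unfolding leibniz_def by blast
    show "(interp A f (xs @ a # ys), interp A f (xs @ b # ys)) \<in> \<Theta>"
      using ab unfolding \<Theta>_def
    proof (induction rule: trancl_induct)
      case (base y)
      thus ?case using one by blast
    next
      case (step y z)
      thus ?case using one by (meson trancl.trancl_into_trancl)
    qed
  qed
  have "b \<in> F" if "(a, b) \<in> \<Theta>" "a \<in> F" for a b
    using that unfolding \<Theta>_def
  proof (induction rule: trancl_induct)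
    case (base y)
    thus ?case unfolding leibniz_def compatible_def by blast
  next
    case (step y z)
    thus ?case unfolding leibniz_def compatible_def by blast
  qed
  thus "compatible \<Theta> F" unfolding compatible_def by blast
qed

lemma leibniz_eq_trancl:
  assumes "algebra ar A"
  shows "(leibniz ar A F)\<^sup>+ = leibniz ar A F"
  using leibniz_trancl[OF assms] by (auto simp: leibniz_def)

lemma leibniz_congruence: "algebra ar A \<Longrightarrow> congruence ar A (leibniz ar A F)"
  using leibniz_trancl(1) leibniz_eq_trancl by metis

lemma leibniz_compatible: "algebra ar A \<Longrightarrow> compatible (leibniz ar A F) F"
  using leibniz_trancl(2) leibniz_eq_trancl by metis

lemma leibniz_greatest:
  "congruence ar A \<theta> \<Longrightarrow> compatible \<theta> F \<Longrightarrow> \<theta> \<subseteq> leibniz ar A F"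
  unfolding leibniz_def by blast

section \<open>Independence of the universe type\<close>

lemma eval_closed:
  assumes "algebra ar A" "range h \<subseteq> carr A" "p \<in> Fm ar"
  shows "eval A h p \<in> carr A"
  using assms(3)
proof induction
  case (Fm_Var v)
  thus ?case using assms(2) by auto
next
  case (Fm_Op ts f)
  thus ?case using assms(1) unfolding algebra_def by (simp add: image_subset_iff)
qed

lemma eval_cong: "(\<And>v. v \<in> vars p \<Longrightarrow> h v = h' v) \<Longrightarrow> eval A h p = eval A h' p"
proof (induction p)
  case (Op f ts)
  hence H: "map (eval A h) ts = map (eval A h') ts" by auto
  show ?case by (simp only: eval.simps H)
qed simp

lemma eval_subst: "eval A h (subst \<sigma> p) = eval A (\<lambda>v. eval A h (\<sigma> v)) p"
proof (induction p)
  case (Op f ts)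
  hence H: "map (\<lambda>t. eval A h (subst \<sigma> t)) ts = map (eval A (\<lambda>v. eval A h (\<sigma> v))) ts" by auto
  show ?case by (simp only: eval.simps subst.simps map_map comp_def H)
qed simp

lemma finite_vars: "finite (vars p)"
  by (induction p) auto

lemma subst_Fm: "p \<in> Fm ar \<Longrightarrow> substitution ar \<sigma> \<Longrightarrow> subst \<sigma> p \<in> Fm ar"
proof (induction rule: Fm.induct)
  case (Fm_Op ts f)
  thus ?case by (auto intro!: Fm.Fm_Op)
qed (simp add: substitution_def)

definition fm_alg :: "('f \<Rightarrow> nat) \<Rightarrow> ('f, 'f fm) alg" where
  "fm_alg ar = \<lparr>carr = Fm ar, interp = Op\<rparr>"

lemma algebra_fm_alg: "algebra ar (fm_alg ar)"
  unfolding algebra_def fm_alg_def by (auto intro: Fm.intros)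

lemma eval_fm_alg: "eval (fm_alg ar) \<sigma> p = subst \<sigma> p"
proof (induction p)
  case (Op f ts)
  hence "map (eval (fm_alg ar) \<sigma>) ts = map (subst \<sigma>) ts" by auto
  thus ?case by (simp add: fm_alg_def)
qed simp

text \<open>Unary polynomial functions built by placing the argument in one position at a time.\<close>

inductive translation :: "('f \<Rightarrow> nat) \<Rightarrow> ('f, 'a) alg \<Rightarrow> ('a \<Rightarrow> 'a) \<Rightarrow> bool"
  for ar :: "'f \<Rightarrow> nat" and A :: "('f, 'a) alg" where
  tr_id: "translation ar A (\<lambda>z. z)"
| tr_op: "translation ar A t \<Longrightarrow> set xs \<subseteq> carr A \<Longrightarrow> set ys \<subseteq> carr A \<Longrightarrow>
     length xs + Suc (length ys) = ar f \<Longrightarrow>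
     translation ar A (\<lambda>z. interp A f (xs @ t z # ys))"

lemma translation_comp:
  assumes "translation ar A t" "set xs \<subseteq> carr A" "set ys \<subseteq> carr A"
    "length xs + Suc (length ys) = ar f"
  shows "translation ar A (\<lambda>z. t (interp A f (xs @ z # ys)))"
  using assms(1)
proof induction
  case tr_id
  show ?case
    using translation.tr_op[where t = "\<lambda>z. z" and xs = xs and ys = ys and f = f]
      translation.tr_id assms(2-4) by blast
next
  case (tr_op t us vs g)
  show ?case
    using translation.tr_op[where t = "\<lambda>z. t (interp A f (xs @ z # ys))"
        and xs = us and ys = vs and f = g] tr_op.IH tr_op.hyps(2-4) by blast
qed

lemma reduced_separation:
  assumes alg: "algebra ar A" and red: "reduced ar A F"
    and ab: "a \<in> carr A" "b \<in> carr A" "a \<noteq> b"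
  shows "\<exists>t. translation ar A t \<and> (t a \<in> F) \<noteq> (t b \<in> F)"
proof (rule ccontr)
  assume no: "\<not> ?thesis"
  define \<theta> where "\<theta> = {(a, b). a \<in> carr A \<and> b \<in> carr A \<and>
      (\<forall>t. translation ar A t \<longrightarrow> (t a \<in> F) = (t b \<in> F))}"
  have "equiv (carr A) \<theta>"
    unfolding equiv_def refl_on_def sym_def trans_def \<theta>_def by auto
  hence "congruence ar A \<theta>"
  proof (rule congruence_if_op1[OF _ _ alg])
    fix f xs ys c d
    assume cd: "(c, d) \<in> \<theta>" and s: "set xs \<subseteq> carr A" "set ys \<subseteq> carr A"
      "length xs + Suc (length ys) = ar f"
    have "interp A f (xs @ c # ys) \<in> carr A" "interp A f (xs @ d # ys) \<in> carr A"
      using cd s alg unfolding algebra_def \<theta>_def by auto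
    thus "(interp A f (xs @ c # ys), interp A f (xs @ d # ys)) \<in> \<theta>"
      using cd translation_comp[where xs = xs and ys = ys and f = f] s unfolding \<theta>_def by blast
  qed
  moreover have "compatible \<theta> F"
    unfolding compatible_def \<theta>_def using translation.tr_id by blast
  ultimately have "\<theta> \<subseteq> Id_on (carr A)"
    using leibniz_greatest red unfolding reduced_def by blast
  moreover have "(a, b) \<in> \<theta>" using no ab unfolding \<theta>_def by blast
  ultimately show False using ab by auto
qed

lemma fresh_vars:
  fixes V :: "nat set"
  assumes "finite V" "set xs \<subseteq> S" "range h \<subseteq> S"
  shows "\<exists>h' vs. range h' \<subseteq> S \<and> (\<forall>v\<in>V. h' v = h v) \<and> length vs = length xs \<and>
    map h' vs = xs \<and> set vs \<inter> V = {}"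
  using assms(2)
proof (induction xs)
  case Nil
  show ?case using assms(3) by (intro exI[of _ h] exI[of _ "[]"]) auto
next
  case (Cons z zs)
  then obtain h' vs where h': "range h' \<subseteq> S" "\<forall>v\<in>V. h' v = h v" "length vs = length zs"
    "map h' vs = zs" "set vs \<inter> V = {}" by auto
  obtain w where w: "w \<notin> V \<union> set vs"
    using ex_new_if_finite[OF infinite_UNIV_nat, of "V \<union> set vs"] assms(1) by auto
  have "map (h'(w := z)) vs = zs" using h' w by auto
  thus ?case using h' w Cons.prems
    by (intro exI[of _ "h'(w := z)"] exI[of _ "w # vs"]) auto
qed

lemma translation_lift:
  fixes ar :: "'f \<Rightarrow> nat"
  assumes "translation ar A t" and "range h \<subseteq> carr A" and "\<phi> \<in> Fm ar" "\<psi> \<in> Fm ar"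
  shows "\<exists>h' \<phi>' \<psi>'. range h' \<subseteq> carr A \<and> (\<forall>v\<in>vars \<phi> \<union> vars \<psi>. h' v = h v) \<and>
    \<phi>' \<in> Fm ar \<and> \<psi>' \<in> Fm ar \<and>
    eval A h' \<phi>' = t (eval A h \<phi>) \<and> eval A h' \<psi>' = t (eval A h \<psi>) \<and>
    (\<forall>\<theta>. congruence ar (fm_alg ar) \<theta> \<longrightarrow> (\<phi>, \<psi>) \<in> \<theta> \<longrightarrow> (\<phi>', \<psi>') \<in> \<theta>)"
  using assms(1)
proof induction
  case tr_id
  show ?case using assms(2-4)
    by (intro exI[of _ h] exI[of _ \<phi>] exI[of _ \<psi>]) auto
next
  case (tr_op t xs ys f)
  then obtain h' \<phi>' \<psi>' where IH: "range h' \<subseteq> carr A" "\<forall>v\<in>vars \<phi> \<union> vars \<psi>. h' v = h v"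
    "\<phi>' \<in> Fm ar" "\<psi>' \<in> Fm ar"
    "eval A h' \<phi>' = t (eval A h \<phi>)" "eval A h' \<psi>' = t (eval A h \<psi>)"
    "\<forall>\<theta>. congruence ar (fm_alg ar) \<theta> \<longrightarrow> (\<phi>, \<psi>) \<in> \<theta> \<longrightarrow> (\<phi>', \<psi>') \<in> \<theta>" by blast
  define V where "V = vars \<phi> \<union> vars \<psi> \<union> vars \<phi>' \<union> vars \<psi>'"
  have "finite V" unfolding V_def by (simp add: finite_vars)
  then obtain k ws where k: "range k \<subseteq> carr A" "\<forall>v\<in>V. k v = h' v"
    "length ws = length (xs @ ys)" "map k ws = xs @ ys"
    using fresh_vars[of V "xs @ ys" "carr A" h'] tr_op.hyps(2,3) IH(1) by auto
  define us where "us = (map Var (take (length xs) ws) :: 'f fm list)"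
  define vs where "vs = (map Var (drop (length xs) ws) :: 'f fm list)"
  have len: "length us = length xs" "length vs = length ys"
    using k(3) unfolding us_def vs_def by auto
  have in_Fm: "set us \<subseteq> Fm ar" "set vs \<subseteq> Fm ar"
    unfolding us_def vs_def by (auto intro: Fm.intros)
  have ev: "map (eval A k) us = xs" "map (eval A k) vs = ys"
    using k(3,4) unfolding us_def vs_def
    by (simp_all add: comp_def take_map[symmetric] drop_map[symmetric])
  have kk: "eval A k \<phi>' = eval A h' \<phi>'" "eval A k \<psi>' = eval A h' \<psi>'"
    using k(2) unfolding V_def by (auto intro: eval_cong)
  have "Op f (us @ \<phi>' # vs) \<in> Fm ar" "Op f (us @ \<psi>' # vs) \<in> Fm ar"
    using in_Fm IH(3,4) len tr_op.hyps(4) by (auto intro!: Fm.Fm_Op)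
  moreover have "(Op f (us @ \<phi>' # vs), Op f (us @ \<psi>' # vs)) \<in> \<theta>"
    if "congruence ar (fm_alg ar) \<theta>" "(\<phi>, \<psi>) \<in> \<theta>" for \<theta>
    using congruence_op1[OF that(1), of \<phi>' \<psi>' us vs f] that IH(7) in_Fm len tr_op.hyps(4)
    by (simp add: fm_alg_def)
  moreover have "\<forall>v\<in>vars \<phi> \<union> vars \<psi>. k v = h v" using k(2) IH(2) unfolding V_def by auto
  ultimately show ?case using k(1) ev kk IH(5,6)
    by (intro exI[of _ k] exI[of _ "Op f (us @ \<phi>' # vs)"] exI[of _ "Op f (us @ \<psi>' # vs)"]) auto
qed

text \<open>Every matrix on the formula algebra has its reduction realised on a set of representatives.\<close>

lemma reduction_in_fm:
  assumes T: "T \<subseteq> Fm ar" and L: "L \<subseteq> Pow (Fm ar) \<times> Fm ar"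
    and model: "matrix_model ar L (fm_alg ar) T"
  shows "\<exists>(B :: ('f, 'f fm) alg) k. B \<in> Alg ar L \<and> range k \<subseteq> carr B \<and>
    (\<forall>\<alpha>\<in>Fm ar. \<forall>\<beta>\<in>Fm ar. eval B k \<alpha> = eval B k \<beta> \<longrightarrow> (\<alpha>, \<beta>) \<in> leibniz ar (fm_alg ar) T)"
proof -
  let ?M = "fm_alg ar"
  define \<Omega> where "\<Omega> = leibniz ar ?M T"
  have cong: "congruence ar ?M \<Omega>" and comp: "compatible \<Omega> T"
    unfolding \<Omega>_def using leibniz_congruence leibniz_compatible algebra_fm_alg by blast+
  have eq: "equiv (Fm ar) \<Omega>" using cong unfolding congruence_def fm_alg_def by simp
  define rep where "rep \<phi> = (SOME \<psi>. (\<phi>, \<psi>) \<in> \<Omega>)" for \<phi>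
  have rep: "(\<phi>, rep \<phi>) \<in> \<Omega>" if "\<phi> \<in> Fm ar" for \<phi>
  proof -
    have "(\<phi>, \<phi>) \<in> \<Omega>" using eq that unfolding equiv_def refl_on_def by blast
    thus ?thesis unfolding rep_def by (rule someI)
  qed
  have rep_eq: "rep \<phi> = rep \<psi>" if "(\<phi>, \<psi>) \<in> \<Omega>" for \<phi> \<psi>
  proof -
    have "(\<phi>, \<chi>) \<in> \<Omega> \<longleftrightarrow> (\<psi>, \<chi>) \<in> \<Omega>" for \<chi>
      using eq that unfolding equiv_def by (meson symD transD)
    thus ?thesis unfolding rep_def by simp
  qed
  have eqD: "(\<phi>, \<psi>) \<in> \<Omega>" if "rep \<phi> = rep \<psi>" "\<phi> \<in> Fm ar" "\<psi> \<in> Fm ar" for \<phi> \<psi>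
    using rep[OF that(2)] rep[OF that(3)] that(1) eq unfolding equiv_def by (metis symD transD)
  have rep_Fm: "rep \<phi> \<in> Fm ar" if "\<phi> \<in> Fm ar" for \<phi>
    using rep[OF that] eq unfolding equiv_def by blast
  have rep_rep: "rep (rep \<phi>) = rep \<phi>" if "\<phi> \<in> Fm ar" for \<phi>
    using rep_eq[OF rep[OF that]] by simp
  have rep_T: "rep \<phi> \<in> T \<longleftrightarrow> \<phi> \<in> T" if "\<phi> \<in> Fm ar" for \<phi>
  proof -
    have "(rep \<phi>, \<phi>) \<in> \<Omega>" using rep[OF that] eq unfolding equiv_def by (meson symD)
    thus ?thesis using rep[OF that] comp unfolding compatible_def by blast
  qed
  define B where "B = \<lparr>carr = rep ` Fm ar, interp = (\<lambda>f ts. rep (Op f ts))\<rparr>"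
  have uB: "carr B = rep ` Fm ar" and iB: "interp B f ts = rep (Op f ts)" for f ts
    by (simp_all add: B_def)
  have BFm: "carr B \<subseteq> Fm ar" using rep_Fm uB by auto
  have algB: "algebra ar B"
    unfolding algebra_def
  proof (intro conjI allI impI)
    show "carr B \<noteq> {}" using Fm.Fm_Var uB by auto
    fix f as assume "length as = ar f" "set as \<subseteq> carr B"
    hence "Op f as \<in> Fm ar" using BFm by (auto intro!: Fm.Fm_Op)
    thus "interp B f as \<in> carr B" using uB iB by auto
  qed
  have rep_Op: "rep (Op f (map rep ts)) = rep (Op f ts)"
    if "length ts = ar f" "set ts \<subseteq> Fm ar" for f ts
  proof -
    have "list_all2 (\<lambda>a b. (a, b) \<in> \<Omega>) ts (map rep ts)"
      using rep that by (auto simp: list_all2_conv_all_nth subset_iff)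
    hence "(Op f ts, Op f (map rep ts)) \<in> \<Omega>"
      using cong that unfolding congruence_def fm_alg_def by simp
    thus ?thesis using rep_eq by metis
  qed
  have evB: "eval B (\<lambda>v. rep (\<sigma> v)) \<phi> = rep (subst \<sigma> \<phi>)"
    if "\<phi> \<in> Fm ar" "substitution ar \<sigma>" for \<sigma> \<phi>
    using that(1)
  proof induction
    case (Fm_Op ts f)
    have H: "map (eval B (\<lambda>v. rep (\<sigma> v))) ts = map rep (map (subst \<sigma>) ts)"
      using Fm_Op by auto
    have "set (map (subst \<sigma>) ts) \<subseteq> Fm ar" using Fm_Op(2) subst_Fm[OF _ that(2)] by auto
    hence "rep (Op f (map rep (map (subst \<sigma>) ts))) = rep (Op f (map (subst \<sigma>) ts))"
      using rep_Op[of "map (subst \<sigma>) ts" f] Fm_Op(1) by simp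
    thus ?case by (simp only: eval.simps subst.simps iB H)
  qed simp
  have LFm: "eval B h \<phi> \<in> T \<longleftrightarrow> subst h \<phi> \<in> T"
    if "range h \<subseteq> carr B" "\<phi> \<in> Fm ar" for h \<phi>
  proof -
    have sub: "substitution ar h" using that BFm unfolding substitution_def by blast
    have "(\<lambda>v. rep (h v)) = h"
    proof
      fix v
      have "h v \<in> rep ` Fm ar" using that(1) uB by blast
      thus "rep (h v) = h v" using rep_rep by auto
    qed
    hence "eval B h \<phi> = rep (subst h \<phi>)" using evB[OF that(2) sub] by simp
    thus ?thesis using rep_T subst_Fm[OF that(2) sub] by simp
  qed
  have modelB: "matrix_model ar L B (T \<inter> carr B)"
    unfolding matrix_model_def
  proof (intro conjI algB ballI, simp, clarify)
    fix \<Gamma> \<phi> h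
    assume G: "(\<Gamma>, \<phi>) \<in> L" and h: "range h \<subseteq> carr B" and sat: "eval B h ` \<Gamma> \<subseteq> T \<inter> carr B"
    have F: "\<Gamma> \<subseteq> Fm ar" "\<phi> \<in> Fm ar" using G L by auto
    have "eval (fm_alg ar) h ` \<Gamma> \<subseteq> T" using sat LFm[OF h] F by (auto simp: eval_fm_alg)
    moreover have "range h \<subseteq> carr (fm_alg ar)" using h BFm by (simp add: fm_alg_def)
    ultimately have "subst h \<phi> \<in> T"
      using model G unfolding matrix_model_def by (auto simp: eval_fm_alg)
    thus "eval B h \<phi> \<in> T \<inter> carr B" using LFm[OF h F(2)] eval_closed[OF algB h F(2)] by simp
  qed
  have redB: "reduced ar B (T \<inter> carr B)"
    unfolding reduced_def
  proof
    show "Id_on (carr B) \<subseteq> leibniz ar B (T \<inter> carr B)"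
      by (rule leibniz_greatest[OF Id_on_congruence[OF algB]]) (auto simp: compatible_def)
    define \<Theta> where "\<Theta> = leibniz ar B (T \<inter> carr B)"
    have cT: "congruence ar B \<Theta>" "compatible \<Theta> (T \<inter> carr B)"
      unfolding \<Theta>_def using leibniz_congruence leibniz_compatible algB by blast+
    have eT: "equiv (carr B) \<Theta>" using cT unfolding congruence_def by simp
    define \<theta> where "\<theta> = {(\<phi>, \<psi>). \<phi> \<in> Fm ar \<and> \<psi> \<in> Fm ar \<and> (rep \<phi>, rep \<psi>) \<in> \<Theta>}"
    have "equiv (Fm ar) \<theta>"
    proof (rule equivI)
      show "\<theta> \<subseteq> Fm ar \<times> Fm ar" unfolding \<theta>_def by auto
      show "refl_on (Fm ar) \<theta>" using eT uB unfolding \<theta>_def equiv_def refl_on_def by auto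
      show "sym \<theta>" using eT unfolding \<theta>_def equiv_def sym_def by auto
      show "trans \<theta>" using eT unfolding \<theta>_def equiv_def trans_def by blast
    qed
    moreover have "(Op f as, Op f bs) \<in> \<theta>"
      if len: "length as = ar f" and ab: "list_all2 (\<lambda>a b. (a, b) \<in> \<theta>) as bs" for f as bs
    proof -
      have lb: "length bs = ar f" using len ab list_all2_lengthD by fastforce
      have n: "as ! i \<in> Fm ar" "bs ! i \<in> Fm ar" "(rep (as ! i), rep (bs ! i)) \<in> \<Theta>" if "i < ar f" for i
        using ab that len unfolding \<theta>_def by (auto dest: list_all2_nthD)
      have s: "set as \<subseteq> Fm ar" "set bs \<subseteq> Fm ar" using n len lb by (auto simp: in_set_conv_nth)
      have "list_all2 (\<lambda>a b. (a, b) \<in> \<Theta>) (map rep as) (map rep bs)"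
        using n len lb by (auto simp: list_all2_conv_all_nth)
      hence "(interp B f (map rep as), interp B f (map rep bs)) \<in> \<Theta>"
        using cT(1) len unfolding congruence_def by simp
      hence "(rep (Op f as), rep (Op f bs)) \<in> \<Theta>" using iB rep_Op s len lb by simp
      thus ?thesis using s len lb unfolding \<theta>_def by (auto intro!: Fm.Fm_Op)
    qed
    ultimately have "congruence ar ?M \<theta>" unfolding congruence_def by (simp add: fm_alg_def)
    moreover have "compatible \<theta> T"
      using cT(2) rep_T uB unfolding compatible_def \<theta>_def by blast
    ultimately have sub: "\<theta> \<subseteq> \<Omega>" unfolding \<Omega>_def by (rule leibniz_greatest)
    show "leibniz ar B (T \<inter> carr B) \<subseteq> Id_on (carr B)"
    proof
      fix q assume q: "q \<in> leibniz ar B (T \<inter> carr B)"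
      obtain a b where ab: "q = (a, b)" by (cases q)
      hence m: "(a, b) \<in> \<Theta>" using q unfolding \<Theta>_def by simp
      hence "a \<in> carr B" "b \<in> carr B" using eT unfolding equiv_def by auto
      then obtain \<phi> \<psi> where "\<phi> \<in> Fm ar" "\<psi> \<in> Fm ar" "a = rep \<phi>" "b = rep \<psi>" using uB by auto
      hence "a = b" using m sub rep_eq unfolding \<theta>_def by blast
      thus "q \<in> Id_on (carr B)" using ab \<open>a \<in> carr B\<close> by auto
    qed
  qed
  have "B \<in> Alg ar L" using modelB redB unfolding Alg_def by blast
  moreover have "range (\<lambda>v. rep (Var v)) \<subseteq> carr B" using uB by (auto intro: Fm.Fm_Var)
  moreover have "(\<alpha>, \<beta>) \<in> \<Omega>"
    if "\<alpha> \<in> Fm ar" "\<beta> \<in> Fm ar" "eval B (\<lambda>v. rep (Var v)) \<alpha> = eval B (\<lambda>v. rep (Var v)) \<beta>" for \<alpha> \<beta>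
  proof -
    have sV: "substitution ar Var" unfolding substitution_def by (auto intro: Fm.Fm_Var)
    have "subst Var \<gamma> = \<gamma>" for \<gamma> :: "'f fm" by (induction \<gamma>) (auto intro: map_idI)
    hence "rep \<alpha> = rep \<beta>" using that evB[OF that(1) sV] evB[OF that(2) sV] by simp
    thus ?thesis using eqD that by blast
  qed
  ultimately show ?thesis unfolding \<Omega>_def by blast
qed

lemma Alg_identity_any_type:
  fixes A :: "('f, 'a) alg"
  assumes L: "L \<subseteq> Pow (Fm ar) \<times> Fm ar" and ab: "\<alpha> \<in> Fm ar" "\<beta> \<in> Fm ar"
    and valid: "\<And>(B :: ('f, 'f fm) alg) k. B \<in> Alg ar L \<Longrightarrow> range k \<subseteq> carr B \<Longrightarrow>
      eval B k \<alpha> = eval B k \<beta>"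
    and A: "A \<in> Alg ar L" and h: "range h \<subseteq> carr A"
  shows "eval A h \<alpha> = eval A h \<beta>"
proof (rule ccontr)
  assume ne: "eval A h \<alpha> \<noteq> eval A h \<beta>"
  obtain F where F: "matrix_model ar L A F" "reduced ar A F" using A unfolding Alg_def by blast
  have alg: "algebra ar A" using F unfolding matrix_model_def by blast
  obtain t where t: "translation ar A t" "(t (eval A h \<alpha>) \<in> F) \<noteq> (t (eval A h \<beta>) \<in> F)"
    using reduced_separation[OF alg F(2) eval_closed[OF alg h ab(1)] eval_closed[OF alg h ab(2)] ne]
    by blast
  obtain h' \<alpha>' \<beta>' where h': "range h' \<subseteq> carr A" "\<alpha>' \<in> Fm ar" "\<beta>' \<in> Fm ar"
    "eval A h' \<alpha>' = t (eval A h \<alpha>)" "eval A h' \<beta>' = t (eval A h \<beta>)"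
    and cl: "\<And>\<theta>. congruence ar (fm_alg ar) \<theta> \<Longrightarrow> (\<alpha>, \<beta>) \<in> \<theta> \<Longrightarrow> (\<alpha>', \<beta>') \<in> \<theta>"
    using translation_lift[OF t(1) h ab] by blast
  define T where "T = {\<chi> \<in> Fm ar. eval A h' \<chi> \<in> F}"
  have T: "T \<subseteq> Fm ar" unfolding T_def by auto
  have "matrix_model ar L (fm_alg ar) T"
    unfolding matrix_model_def
  proof (intro conjI algebra_fm_alg ballI, simp add: T fm_alg_def, clarify)
    fix \<Gamma> \<phi> \<sigma>
    assume G: "(\<Gamma>, \<phi>) \<in> L" and s: "range \<sigma> \<subseteq> carr (fm_alg ar)"
      and sat: "eval (fm_alg ar) \<sigma> ` \<Gamma> \<subseteq> T"
    have F': "\<phi> \<in> Fm ar" using G L by auto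
    have s': "substitution ar \<sigma>" using s unfolding substitution_def fm_alg_def by auto
    have r: "range (\<lambda>v. eval A h' (\<sigma> v)) \<subseteq> carr A"
      using s' eval_closed[OF alg h'(1)] unfolding substitution_def by auto
    have "eval A (\<lambda>v. eval A h' (\<sigma> v)) ` \<Gamma> \<subseteq> F"
      using sat by (auto simp: eval_fm_alg T_def eval_subst)
    hence "eval A (\<lambda>v. eval A h' (\<sigma> v)) \<phi> \<in> F"
      using F(1) G r unfolding matrix_model_def by blast
    thus "eval (fm_alg ar) \<sigma> \<phi> \<in> T"
      using subst_Fm[OF F' s'] by (simp add: eval_fm_alg T_def eval_subst)
  qed
  from reduction_in_fm[OF T L this] obtain B :: "('f, 'f fm) alg" and k
    where "B \<in> Alg ar L" "range k \<subseteq> carr B"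
      "eval B k \<alpha> = eval B k \<beta> \<Longrightarrow> (\<alpha>, \<beta>) \<in> leibniz ar (fm_alg ar) T" using ab by blast
  hence "(\<alpha>, \<beta>) \<in> leibniz ar (fm_alg ar) T" using valid by blast
  hence m: "(\<alpha>', \<beta>') \<in> leibniz ar (fm_alg ar) T"
    using cl leibniz_congruence[OF algebra_fm_alg] by blast
  moreover have "(\<beta>', \<alpha>') \<in> leibniz ar (fm_alg ar) T"
    using m leibniz_congruence[OF algebra_fm_alg, of ar T]
    unfolding congruence_def equiv_def by (meson symD)
  ultimately have "\<alpha>' \<in> T \<longleftrightarrow> \<beta>' \<in> T"
    using leibniz_compatible[OF algebra_fm_alg, of ar T] unfolding compatible_def by blast
  thus False using t(2) h' unfolding T_def by auto
qed

lemma Alg_partition_function_any_type: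
  fixes A :: "('f, 'a) alg"
  assumes L: "L \<subseteq> Pow (Fm ar) \<times> Fm ar" and p: "p \<in> Fm ar"
    and pf: "Alg_partition_function ar L x y p" and A: "A \<in> Alg ar L"
  shows "partition_function ar A (bin_op A x y p)"
proof -
  define m where "m s t = subst (\<lambda>v. if v = x then s else t) p" for s t
  have mFm: "m s t \<in> Fm ar" if "s \<in> Fm ar" "t \<in> Fm ar" for s t
    unfolding m_def using p that by (intro subst_Fm) (auto simp: substitution_def)
  have ev: "eval B k (m s t) = bin_op B x y p (eval B k s) (eval B k t)"
    for B :: "('f, 'b) alg" and k s t
    unfolding m_def bin_op_def by (simp add: eval_subst if_distrib)
  have evF: "eval B k (foldl m s ts) = foldl (bin_op B x y p) (eval B k s) (map (eval B k) ts)"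
    for B :: "('f, 'b) alg" and k s ts
    by (induction ts arbitrary: s) (simp_all add: ev)
  have fFm: "foldl m s ts \<in> Fm ar" if "s \<in> Fm ar" "set ts \<subseteq> Fm ar" for s ts
    using that by (induction ts arbitrary: s) (simp_all add: mFm)
  have V: "Var v \<in> Fm ar" for v by (rule Fm.Fm_Var)
  note V [simp] mFm [simp]
  have pB: "partition_function ar B (bin_op B x y p)" if "B \<in> Alg ar L" for B :: "('f, 'f fm) alg"
    using pf that unfolding Alg_partition_function_def by blast
  have kB: "k v \<in> carr B" if "range k \<subseteq> carr B" for k :: "nat \<Rightarrow> 'f fm" and B :: "('f, 'f fm) alg" and v
    using that by auto
  note tr = Alg_identity_any_type[OF L _ _ _ A]
  let ?m = "bin_op A x y p"
  have "?m a a = a" if "a \<in> carr A" for a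
  proof -
    have "eval A (\<lambda>v. a) (m (Var 0) (Var 0)) = eval A (\<lambda>v. a) (Var 0)"
    proof (rule tr)
      fix B :: "('f, 'f fm) alg" and k :: "nat \<Rightarrow> 'f fm"
      assume B: "B \<in> Alg ar L" "range k \<subseteq> carr B"
      show "eval B k (m (Var 0) (Var 0)) = eval B k (Var 0)"
        using pB[OF B(1)] kB[OF B(2)] unfolding partition_function_def by (simp add: ev)
    qed (use that in auto)
    thus ?thesis by (simp add: ev)
  qed
  moreover have "?m a (?m b c) = ?m (?m a b) c \<and> ?m a (?m b c) = ?m a (?m c b)"
    if "a \<in> carr A" "b \<in> carr A" "c \<in> carr A" for a b c
  proof -
    define h where "h v = (if v = 0 then a else if v = 1 then b else c)" for v :: nat
    have h: "range h \<subseteq> carr A" using that unfolding h_def by auto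
    let ?x = "Var 0" and ?y = "Var 1" and ?z = "Var 2"
    have "eval A h (m ?x (m ?y ?z)) = eval A h (m (m ?x ?y) ?z)"
    proof (rule tr[OF _ _ _ h])
      fix B :: "('f, 'f fm) alg" and k :: "nat \<Rightarrow> 'f fm"
      assume B: "B \<in> Alg ar L" "range k \<subseteq> carr B"
      show "eval B k (m ?x (m ?y ?z)) = eval B k (m (m ?x ?y) ?z)"
        using pB[OF B(1)] kB[OF B(2)] unfolding partition_function_def by (simp add: ev)
    qed auto
    moreover have "eval A h (m ?x (m ?y ?z)) = eval A h (m ?x (m ?z ?y))"
    proof (rule tr[OF _ _ _ h])
      fix B :: "('f, 'f fm) alg" and k :: "nat \<Rightarrow> 'f fm"
      assume B: "B \<in> Alg ar L" "range k \<subseteq> carr B"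
      have "\<forall>a\<in>carr B. \<forall>b\<in>carr B. \<forall>c\<in>carr B.
          bin_op B x y p a (bin_op B x y p b c) = bin_op B x y p a (bin_op B x y p c b)"
        using pB[OF B(1)] unfolding partition_function_def by blast
      hence "bin_op B x y p (k 0) (bin_op B x y p (k 1) (k 2)) =
          bin_op B x y p (k 0) (bin_op B x y p (k 2) (k 1))"
        using kB[OF B(2)] by blast
      thus "eval B k (m ?x (m ?y ?z)) = eval B k (m ?x (m ?z ?y))" by (simp add: ev)
    qed auto
    ultimately show ?thesis by (simp add: ev h_def)
  qed
  moreover have "?m (interp A g as) b = interp A g (map (\<lambda>a. ?m a b) as) \<and>
      ?m b (interp A g as) = foldl ?m b as"
    if "b \<in> carr A" "ar g \<ge> 1" "length as = ar g" "set as \<subseteq> carr A" for b g as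
  proof -
    define n where "n = ar g"
    define h where "h v = (if v < n then as ! v else b)" for v
    have h: "range h \<subseteq> carr A" using that unfolding h_def n_def by (auto simp: subset_iff)
    let ?vs = "map Var [0..<n] :: 'f fm list"
    have vs: "Op g ?vs \<in> Fm ar" unfolding n_def by (auto intro!: Fm.Fm_Op)
    have as: "map (eval A h) ?vs = as"
      using that(3) unfolding n_def h_def by (auto intro: nth_equalityI)
    have lhs: "m (Op g ?vs) (Var n) \<in> Fm ar" "m (Var n) (Op g ?vs) \<in> Fm ar" using vs by auto
    have rhs: "Op g (map (\<lambda>t. m t (Var n)) ?vs) \<in> Fm ar"
      unfolding n_def by (auto intro!: Fm.Fm_Op)
    have rhs2: "foldl m (Var n) ?vs \<in> Fm ar" by (rule fFm) auto
    have g1: "eval A h (m (Op g ?vs) (Var n)) = eval A h (Op g (map (\<lambda>t. m t (Var n)) ?vs))"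
    proof (rule tr[OF lhs(1) rhs _ h])
      fix B :: "('f, 'f fm) alg" and k :: "nat \<Rightarrow> 'f fm"
      assume B: "B \<in> Alg ar L" "range k \<subseteq> carr B"
      let ?as = "map (eval B k) ?vs"
      have as': "length ?as = ar g" "set ?as \<subseteq> carr B" using kB[OF B(2)] by (auto simp: n_def)
      have "bin_op B x y p (interp B g ?as) (k n) = interp B g (map (\<lambda>a. bin_op B x y p a (k n)) ?as)"
        using pB[OF B(1)] kB[OF B(2), of n] that(2) as' unfolding partition_function_def by blast
      thus "eval B k (m (Op g ?vs) (Var n)) = eval B k (Op g (map (\<lambda>t. m t (Var n)) ?vs))"
        by (simp add: ev comp_def)
    qed
    have g2: "eval A h (m (Var n) (Op g ?vs)) = eval A h (foldl m (Var n) ?vs)"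
    proof (rule tr[OF lhs(2) rhs2 _ h])
      fix B :: "('f, 'f fm) alg" and k :: "nat \<Rightarrow> 'f fm"
      assume B: "B \<in> Alg ar L" "range k \<subseteq> carr B"
      let ?as = "map (eval B k) ?vs"
      have as': "length ?as = ar g" "set ?as \<subseteq> carr B" using kB[OF B(2)] by (auto simp: n_def)
      have "bin_op B x y p (k n) (interp B g ?as) = foldl (bin_op B x y p) (k n) ?as"
        using pB[OF B(1)] kB[OF B(2), of n] that(2) as' unfolding partition_function_def by blast
      thus "eval B k (m (Var n) (Op g ?vs)) = eval B k (foldl m (Var n) ?vs)"
        by (simp only: ev evF eval.simps)
    qed
    have hn: "h n = b" by (simp add: h_def)
    have "?m (interp A g as) b = interp A g (map (eval A h) (map (\<lambda>t. m t (Var n)) ?vs))"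
      using g1 by (simp only: ev eval.simps as hn)
    also have "map (eval A h) (map (\<lambda>t. m t (Var n)) ?vs) = map (\<lambda>a. ?m a b) (map (eval A h) ?vs)"
      by (simp add: ev hn)
    finally have "?m (interp A g as) b = interp A g (map (\<lambda>a. ?m a b) as)" by (simp only: as)
    moreover have "?m b (interp A g as) = foldl ?m b as"
      using g2 by (simp only: ev evF eval.simps as hn)
    ultimately show ?thesis by blast
  qed
  ultimately show ?thesis unfolding partition_function_def by blast
qed

end

theory Submission
  imports Defs
begin

text \<open>
  Without antitheorems both companions are defined by variable inclusion conditions alone:
  \<open>\<turnstile>\<^sup>l\<^sup>r\<close> consists of the rules of \<open>\<turnstile>\<^sup>l\<close> with \<open>Var(\<phi>) \<subseteq> Var(\<Gamma>)\<close>, which is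
  \<open>\<turnstile>\<^sup>l \<inter> \<turnstile>\<^sup>r\<close>, and \<open>\<Gamma> \<turnstile>\<^sup>r\<^sup>l \<phi>\<close> means that \<open>\<Delta> \<turnstile> \<phi>\<close> for some
  \<open>\<Delta> \<subseteq> \<Gamma>\<close> with \<open>Var(\<Delta>) = Var(\<phi>)\<close>, a condition that is stable under both operations.
  The two rules \<open>x \<turnstile>\<^sup>l \<pi>(x,y)\<close> and \<open>\<pi>(x,y) \<turnstile>\<^sup>r x\<close> show that \<open>\<turnstile>\<^sup>l\<close> and \<open>\<turnstile>\<^sup>r\<close> are
  incomparable; for the second one, a theorem \<open>x\<close> would turn the empty set into an antitheorem.
\<close>

lemma antitheorem_mono: "antitheorem ar L' \<Sigma> \<Longrightarrow> L' \<subseteq> L \<Longrightarrow> antitheorem ar L \<Sigma>"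
  unfolding antitheorem_def by blast

lemma is_logic_weaken:
  assumes "is_logic ar L" "(\<Delta>, \<phi>) \<in> L" "\<Delta> \<subseteq> \<Gamma>" "\<Gamma> \<subseteq> Fm ar"
  shows "(\<Gamma>, \<phi>) \<in> L"
  using assms unfolding is_logic_def by (meson subsetD)

text \<open>Constant substitutions turn the theorem \<open>Var x\<close> into any formula, and every
  substitution maps \<open>{}\<close> to itself.\<close>

lemma antitheorem_empty_if_theorem_Var:
  assumes L: "is_logic ar L" and x: "({}, Var x) \<in> L"
  shows "antitheorem ar L {}"
  unfolding antitheorem_def
proof (intro conjI allI impI)
  fix \<phi> assume "\<phi> \<in> Fm ar"
  then have "substitution ar (\<lambda>_. \<phi>)" by (simp add: substitution_def)
  then have "(subst (\<lambda>_. \<phi>) ` {}, subst (\<lambda>_. \<phi>) (Var x)) \<in> L"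
    using L x unfolding is_logic_def by blast
  then show "(subst \<sigma> ` {}, \<phi>) \<in> L" for \<sigma> by simp
qed simp

lemma left_compI:
  assumes "\<Gamma> \<subseteq> Fm ar" "\<phi> \<in> Fm ar" "\<Delta> \<subseteq> \<Gamma>" "Vars \<Delta> \<subseteq> vars \<phi>" "(\<Delta>, \<phi>) \<in> L"
  shows "(\<Gamma>, \<phi>) \<in> left_comp ar L"
  using assms unfolding left_comp_def by auto

lemma left_compE:
  assumes "(\<Gamma>, \<phi>) \<in> left_comp ar L"
  obtains \<Delta> where "\<Gamma> \<subseteq> Fm ar" "\<phi> \<in> Fm ar" "\<Delta> \<subseteq> \<Gamma>" "Vars \<Delta> \<subseteq> vars \<phi>" "(\<Delta>, \<phi>) \<in> L"
  using assms unfolding left_comp_def by auto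

lemma left_comp_mono: "L' \<subseteq> L \<Longrightarrow> left_comp ar L' \<subseteq> left_comp ar L"
  by (rule subrelI, erule left_compE, rule left_compI) auto

lemma left_comp_subset:
  assumes "is_logic ar L"
  shows "left_comp ar L \<subseteq> L"
proof (rule subrelI)
  fix \<Gamma> \<phi> assume "(\<Gamma>, \<phi>) \<in> left_comp ar L"
  then show "(\<Gamma>, \<phi>) \<in> L" by (rule left_compE) (rule is_logic_weaken[OF assms])
qed

lemma left_comp_idem: "left_comp ar (left_comp ar L) = left_comp ar L"
proof (intro equalityI subrelI)
  fix \<Gamma> \<phi> assume "(\<Gamma>, \<phi>) \<in> left_comp ar (left_comp ar L)"
  then obtain \<Delta> where D: "\<Gamma> \<subseteq> Fm ar" "\<phi> \<in> Fm ar" "\<Delta> \<subseteq> \<Gamma>" "(\<Delta>, \<phi>) \<in> left_comp ar L"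
    by (rule left_compE)
  from D(4) obtain \<Delta>' where "\<Delta>' \<subseteq> \<Delta>" "Vars \<Delta>' \<subseteq> vars \<phi>" "(\<Delta>', \<phi>) \<in> L"
    by (rule left_compE)
  with D show "(\<Gamma>, \<phi>) \<in> left_comp ar L"
    by (intro left_compI[of \<Gamma> ar \<phi> \<Delta>']) auto
next
  fix \<Gamma> \<phi> assume "(\<Gamma>, \<phi>) \<in> left_comp ar L"
  then obtain \<Delta> where D: "\<Gamma> \<subseteq> Fm ar" "\<phi> \<in> Fm ar" "\<Delta> \<subseteq> \<Gamma>" "Vars \<Delta> \<subseteq> vars \<phi>" "(\<Delta>, \<phi>) \<in> L"
    by (rule left_compE)
  moreover from D have "(\<Delta>, \<phi>) \<in> left_comp ar L"
    by (intro left_compI[of \<Delta> ar \<phi> \<Delta>]) auto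
  ultimately show "(\<Gamma>, \<phi>) \<in> left_comp ar (left_comp ar L)"
    by (intro left_compI[of \<Gamma> ar \<phi> \<Delta>])
qed

lemma right_comp_eq:
  assumes "\<not> (\<exists>\<Sigma>. antitheorem ar L \<Sigma>)"
  shows "right_comp ar L =
    {(\<Gamma>, \<phi>). \<Gamma> \<subseteq> Fm ar \<and> \<phi> \<in> Fm ar \<and> (\<Gamma>, \<phi>) \<in> L \<and> vars \<phi> \<subseteq> Vars \<Gamma>}"
  using assms unfolding right_comp_def by auto

text \<open>Both companions constrain the same \<Delta>, one by each inclusion, so its variables are
  exactly those of \<phi>.\<close>

lemma right_left_comp_eq:
  assumes "\<not> (\<exists>\<Sigma>. antitheorem ar L \<Sigma>)"
  shows "left_comp ar (right_comp ar L) =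
    {(\<Gamma>, \<phi>). \<Gamma> \<subseteq> Fm ar \<and> \<phi> \<in> Fm ar \<and> (\<exists>\<Delta>\<subseteq>\<Gamma>. Vars \<Delta> = vars \<phi> \<and> (\<Delta>, \<phi>) \<in> L)}"
  (is "_ = ?R")
proof (intro equalityI subrelI)
  fix \<Gamma> \<phi> assume "(\<Gamma>, \<phi>) \<in> left_comp ar (right_comp ar L)"
  then obtain \<Delta> where "\<Gamma> \<subseteq> Fm ar" "\<phi> \<in> Fm ar" "\<Delta> \<subseteq> \<Gamma>" "Vars \<Delta> \<subseteq> vars \<phi>"
    "(\<Delta>, \<phi>) \<in> right_comp ar L"
    by (rule left_compE)
  then show "(\<Gamma>, \<phi>) \<in> ?R"
    unfolding right_comp_eq[OF assms] by auto
next
  fix \<Gamma> \<phi> assume "(\<Gamma>, \<phi>) \<in> ?R"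
  then obtain \<Delta> where "\<Gamma> \<subseteq> Fm ar" "\<phi> \<in> Fm ar" "\<Delta> \<subseteq> \<Gamma>" "Vars \<Delta> = vars \<phi>" "(\<Delta>, \<phi>) \<in> L"
    by auto
  then show "(\<Gamma>, \<phi>) \<in> left_comp ar (right_comp ar L)"
    unfolding right_comp_eq[OF assms] by (intro left_compI[of \<Gamma> ar \<phi> \<Delta>]) auto
qed

lemma foldl_fixpoint: "(\<And>u. f a u = a) \<Longrightarrow> foldl f a us = a"
  by (induction us) simp_all

theorem theorem4p4:
  fixes ar :: "'f \<Rightarrow> nat" and L :: "'f logic"
  assumes "is_logic ar L"
    and "finitary ar L"
    and "\<exists>p x y. binary_formula ar x y p \<and>
           l_partition_function ar (left_comp ar L) x y p \<and>
           r_partition_function ar (right_comp ar L) x y p"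
    and "\<not> (\<exists>\<Sigma>. antitheorem ar L \<Sigma>)"
    and "L \<noteq> right_comp ar L"
    and "L \<noteq> left_comp ar L"
  shows "(\<not> left_comp ar L \<subseteq> right_comp ar L \<and> \<not> right_comp ar L \<subseteq> left_comp ar L) \<and>
    (left_comp ar L \<inter> right_comp ar L = comp_seq ar L [Lft, Rgt] \<and>
      comp_seq ar L [Lft, Rgt] \<subset> left_comp ar L \<and>
      comp_seq ar L [Lft, Rgt] \<subset> right_comp ar L) \<and>
    (\<forall>us. comp_seq ar L [Rgt, Lft] = comp_seq ar L ([Rgt, Lft] @ us) \<and>
      comp_seq ar L ([Rgt, Lft] @ us) = comp_seq ar L ([Lft, Rgt, Lft] @ us))"
proof -
  let ?l = "left_comp ar" and ?r = "right_comp ar"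
  note L = assms(1) and noanti = assms(4)
  obtain p x y where p: "binary_formula ar x y p"
    "({Var x}, p) \<in> ?l L" "({p}, Var x) \<in> ?r L"
    using assms(3) unfolding l_partition_function_def r_partition_function_def by blast
  have v: "vars p = {x, y}" "x \<noteq> y" using p(1) unfolding binary_formula_def by auto
  have lL: "?l L \<subseteq> L" by (rule left_comp_subset[OF L])
  \<comment> \<open>Antitheorems pass to larger relations, so \<open>right_comp_eq\<close> also
    applies to \<open>?l L\<close> and \<open>?l (?r L)\<close>.\<close>
  have noanti': "\<not> (\<exists>\<Sigma>. antitheorem ar L' \<Sigma>)" if "L' \<subseteq> L" for L'
    using noanti antitheorem_mono[OF _ that] by blast
  note r = right_comp_eq[OF noanti]
  note lr = right_comp_eq[OF noanti'[OF lL]]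
  note rl = right_left_comp_eq[OF noanti]

  \<comment> \<open>The variable \<open>y\<close> occurs in \<open>p\<close> but not in the
    premise.\<close>
  have "({Var x}, p) \<notin> ?r L"
    using v unfolding r by (auto simp: Vars_def)
  then have not_lr: "\<not> ?l L \<subseteq> ?r L" using p(2) by blast
  have "({p}, Var x) \<notin> ?l L"
  proof
    assume "({p}, Var x) \<in> ?l L"
    then obtain \<Delta> where D: "\<Delta> \<subseteq> {p}" "Vars \<Delta> \<subseteq> {x}" "(\<Delta>, Var x) \<in> L"
      unfolding left_comp_def by auto
    \<comment> \<open>The only other candidate \<open>{p}\<close> would contribute
      \<open>y\<close>.\<close>
    then have "\<Delta> = {}" using v by (auto simp: Vars_def)
    then show False using D(3) antitheorem_empty_if_theorem_Var[OF L] noanti by blast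
  qed
  then have not_rl: "\<not> ?r L \<subseteq> ?l L" using p(3) by blast

  have meet: "?l L \<inter> ?r L = ?r (?l L)"
    using lL unfolding lr r by auto

  have rlL: "?l (?r L) \<subseteq> L"
    using left_comp_mono[of "?r L" L ar] lL unfolding r by auto
  have "?l (?l (?r L)) = ?l (?r L)"
    by (rule left_comp_idem)
  moreover have "?r (?l (?r L)) = ?l (?r L)"
  proof -
    \<comment> \<open>The witness \<Delta> already brings all variables of \<phi> into \<Gamma>, so
      the inclusion demanded by \<open>?r\<close> is automatic.\<close>
    have "vars \<phi> \<subseteq> Vars \<Gamma>" if "\<Delta> \<subseteq> \<Gamma>" "Vars \<Delta> = vars \<phi>" for \<Gamma> \<Delta> and \<phi> :: "'f fm"
      using that unfolding Vars_def by (metis UN_mono order_refl)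
    then show ?thesis
      unfolding right_comp_eq[OF noanti'[OF rlL]] unfolding rl by auto
  qed
  ultimately have "side_comp ar (?l (?r L)) u = ?l (?r L)" for u
    by (cases u) simp_all
  then have fix_rl: "foldl (side_comp ar) (?l (?r L)) us = ?l (?r L)" for us
    by (rule foldl_fixpoint)
  \<comment> \<open>Here \<Delta> is its own witness for \<open>?l\<close>. Hence starting from
    \<open>?l L\<close> instead of \<open>L\<close> does not change the characterisation
    \<open>rl\<close>.\<close>
  have in_l: "(\<Delta>, \<phi>) \<in> ?l L \<longleftrightarrow> (\<Delta>, \<phi>) \<in> L" if "Vars \<Delta> = vars \<phi>" for \<Delta> \<phi>
  proof
    assume "(\<Delta>, \<phi>) \<in> L"
    moreover from this have "\<Delta> \<subseteq> Fm ar" "\<phi> \<in> Fm ar"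
      using L unfolding is_logic_def by auto
    ultimately show "(\<Delta>, \<phi>) \<in> ?l L"
      using that unfolding left_comp_def by auto
  qed (use lL in blast)
  have lrl: "?l (?r (?l L)) = ?l (?r L)"
    unfolding rl right_left_comp_eq[OF noanti'[OF lL]] by (simp add: in_l cong: conj_cong)

  show ?thesis
    \<comment> \<open>By \<open>meet\<close>, \<open>?r (?l L)\<close> is the intersection of two
      incomparable sets, hence strictly below both.\<close>
    using not_lr not_rl
    by (simp add: comp_seq_def fix_rl lrl) (auto simp flip: meet)
qed

end
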